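(* Let $(X,D,K)$ be a complete metric type space and $\{T_\alpha\}_{\alpha\in J}$ a family of self mappings of $X$. Suppose there exists a fixed $\beta\in J$ such that for each $\alpha\in J$ there is some $\lambda=\lambda(\alpha)\in[0,1)$ with $\lambda K<1$ such that for all $x,y\in X$ $$D(T_\alpha x,T_\beta y)\le\lambda\max\left\{D(x,y),\,D(x,T_\alpha x),\,D(y,T_\beta y),\,\tfrac12\big[D(x,T_\beta y)+D(y,T_\alpha x)\big]\right\}.$$ Then all the $T_\alpha$ have a unique common fixed point, and this point is the unique fixed point of each $T_\alpha$, $\alpha\in J$.
   Context: A metric type space $(X,D,K)$ consists of a nonempty set $X$, a function $D:X\times X\to[0,\infty)$ and a constant $K\ge 1$ such that: (D1) $D(x,x)=0$ for all $x\in X$, and $D(x,y)=0$ implies $x=y$; (D2) $D(x,y)=D(y,x)$ for all $x,y\in X$; (D3) $D(x,y)\le K\big(D(x,z_1)+D(z_1,z_2)+\cdots+D(z_n,y)\big)$ for all $x,y,z_1,\dots,z_n\in X$, where $n\ge1$ is a fixed natural number. Convergence, Cauchy sequences and completeness are defined as for metric spaces: $x_m\to x$ means $D(x_m,x)\to0$; $(x_m)$ is Cauchy if $D(x_m,x_k)\to0$ as $m,k\to\infty$; $X$ is complete if every Cauchy sequence in $X$ converges in $X$. A point $u\in X$ is a common fixed point of the family $\{T_\alpha\}_{\alpha\in J}$ ($J$ an index set) if $u=T_\alpha(u)$ for each $\alpha\in J$. *)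

theory Defs
  imports Complex_Main "HOL-Library.FuncSet"
begin

text \<open>
  The number \<open>n\<close> of intermediate points in the relaxed polygonal inequality is
  fixed, and is therefore a parameter of the structure. The intermediate points
  are the values \<open>z 1, \<dots>, z n\<close>; the other values of \<open>z\<close> are irrelevant. Likewise
  \<open>D\<close> is only constrained on \<open>X\<close>.
\<close>
locale metric_type_space =
  fixes X :: "'a set" and D :: "'a \<Rightarrow> 'a \<Rightarrow> real" and K :: real and n :: nat
  assumes nonempty: "X \<noteq> {}"
    and K_ge_1: "K \<ge> 1"
    and n_ge_1: "n \<ge> 1"
    and D_nonneg: "\<lbrakk>x \<in> X; y \<in> X\<rbrakk> \<Longrightarrow> D x y \<ge> 0"
    and D_self: "x \<in> X \<Longrightarrow> D x x = 0"
    and D_zero_imp_eq: "\<lbrakk>x \<in> X; y \<in> X; D x y = 0\<rbrakk> \<Longrightarrow> x = y"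
    and D_sym: "\<lbrakk>x \<in> X; y \<in> X\<rbrakk> \<Longrightarrow> D x y = D y x"
    and D_polygon: "\<lbrakk>x \<in> X; y \<in> X; \<And>i. i \<in> {1..n} \<Longrightarrow> z i \<in> X\<rbrakk>
      \<Longrightarrow> D x y \<le> K * (D x (z 1) + (\<Sum>i = 1..<n. D (z i) (z (Suc i))) + D (z n) y)"

definition mt_converges :: "('a \<Rightarrow> 'a \<Rightarrow> real) \<Rightarrow> (nat \<Rightarrow> 'a) \<Rightarrow> 'a \<Rightarrow> bool" where
  "mt_converges D s x \<longleftrightarrow> (\<lambda>m. D (s m) x) \<longlonglongrightarrow> 0"

definition mt_Cauchy :: "('a \<Rightarrow> 'a \<Rightarrow> real) \<Rightarrow> (nat \<Rightarrow> 'a) \<Rightarrow> bool" where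
  "mt_Cauchy D s \<longleftrightarrow>
     ((\<lambda>(m, k). D (s m) (s k)) \<longlongrightarrow> 0) (sequentially \<times>\<^sub>F sequentially)"

definition mt_complete :: "'a set \<Rightarrow> ('a \<Rightarrow> 'a \<Rightarrow> real) \<Rightarrow> bool" where
  "mt_complete X D \<longleftrightarrow>
     (\<forall>s. range s \<subseteq> X \<and> mt_Cauchy D s \<longrightarrow> (\<exists>x\<in>X. mt_converges D s x))"

definition common_fixed_point ::
    "'a set \<Rightarrow> 'i set \<Rightarrow> ('i \<Rightarrow> 'a \<Rightarrow> 'a) \<Rightarrow> 'a \<Rightarrow> bool" where
  "common_fixed_point X J T u \<longleftrightarrow> u \<in> X \<and> (\<forall>\<alpha>\<in>J. u = T \<alpha> u)"

end

theory Submission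
  imports Defs
begin

text \<open>
  Repeating one intermediate point in the polygonal inequality gives the relaxed triangle inequality
  \<open>D x y \<le> K * (D x z + D z y)\<close>, on which the existence proof rests.

  Everything reduces to the single map \<open>T \<beta>\<close>. Suppose that \<open>T \<beta> u = u\<close>. Comparing \<open>T \<alpha> u\<close> with
  \<open>T \<beta> u = u\<close>, every term of the maximum is at most \<open>D u (T \<alpha> u)\<close>, so
  \<open>D (T \<alpha> u) u \<le> l * D u (T \<alpha> u)\<close> with the factor \<open>l < 1\<close> belonging to \<open>\<alpha>\<close>, and
  \<open>T \<alpha> u = u\<close>. If \<open>T \<alpha> v = v\<close>, comparing \<open>T \<alpha> v\<close> with
  \<open>T \<beta> u\<close> bounds every term by \<open>D v u\<close>, so \<open>v = u\<close> (\<open>common_fixed_of_fixed\<close>,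
  \<open>fixed_points_coincide\<close>).

  The existence of a fixed point of \<open>T \<beta>\<close> is the case \<open>\<alpha> = \<beta>\<close> of the hypothesis. Write \<open>T\<close> for
  \<open>T \<beta>\<close> and \<open>l\<close> for its factor. Along an orbit \<open>s\<close> of \<open>T\<close>, the consecutive
  distances shrink by the factor \<open>l * K < 1\<close>
  (\<open>orbit_step_contracts\<close>). The summation that proves an orbit Cauchy in a metric space
  would need the ratio to be below \<open>1 / K\<close> here; instead the orbit is cut into blocks so long that the
  ratio over a whole block beats \<open>K\<close> (\<open>geometric_steps_bound\<close>). At the limit \<open>u\<close>, put
  \<open>a = D u (T u)\<close>. Since \<open>D\<close> need not be continuous, \<open>D (s k) (T u)\<close> need not tend to \<open>a\<close>;
  it is however eventually at most \<open>l * a\<close> plus any prescribed error (\<open>halving_recursion_bound\<close>), and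
  the relaxed triangle inequality then gives \<open>a \<le> K * l * a\<close>, hence \<open>a = 0\<close>.
\<close>

section \<open>The relaxed triangle inequality and Cauchy sequences\<close>

lemma (in metric_type_space) relaxed_triangle:
  assumes "x \<in> X" "y \<in> X" "z \<in> X"
  shows "D x y \<le> K * (D x z + D z y)"
  using D_polygon[of x y "\<lambda>_. z"] assms D_self by simp

text \<open>
  Peeling off the first step of a chain multiplies all the later steps by another factor \<open>K\<close>. Unless
  the steps shrink faster than \<open>1 / K ^ t\<close>, the bound is therefore useful only for chains of bounded
  length.
\<close>
lemma (in metric_type_space) chain_bound:
  assumes "range s \<subseteq> X"
  shows "D (s i) (s (i + p)) \<le> (\<Sum>t<p. K ^ Suc t * D (s (i + t)) (s (Suc (i + t))))"
proof (induction p arbitrary: i)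
  case 0
  have "s i \<in> X"
    using assms by auto
  then show ?case using D_self by simp
next
  case (Suc p)
  have sX: "s j \<in> X" for j
    using assms by auto
  have "D (s i) (s (i + Suc p))
      \<le> K * (D (s i) (s (Suc i)) + D (s (Suc i)) (s (Suc i + p)))"
    using relaxed_triangle[OF sX[of i] sX[of "i + Suc p"] sX[of "Suc i"]] by simp
  also have "\<dots> \<le> K * (D (s i) (s (Suc i))
      + (\<Sum>t<p. K ^ Suc t * D (s (Suc i + t)) (s (Suc (Suc i + t)))))"
    using Suc.IH[of "Suc i"] K_ge_1 by (intro mult_left_mono add_left_mono) auto
  also have "\<dots> = (\<Sum>t<Suc p. K ^ Suc t * D (s (i + t)) (s (Suc (i + t))))"
    by (simp add: sum.lessThan_Suc_shift distrib_left sum_distrib_left mult.assoc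
        del: sum.lessThan_Suc)
  finally show ?case .
qed

text \<open>
  Every ratio \<open>h < 1\<close> suffices, however large \<open>K\<close> is. Take a block length \<open>m\<close> with
  \<open>K * h ^ m \<le> 1 / 2\<close>. Jumps of length at most \<open>m\<close> from \<open>i\<close> are at most \<open>A * h ^ i\<close> by
  \<open>chain_bound\<close>. A longer jump is a block followed by a shorter jump from \<open>i + m\<close>; if the latter is at
  most \<open>2 * K * A * h ^ (i + m)\<close>, then the former is at most
  \<open>K * A * h ^ i + K * h ^ m * (2 * K * A * h ^ i) \<le> 2 * K * A * h ^ i\<close>, so the constant
  \<open>2 * K * A\<close> reproduces itself.
\<close>
lemma (in metric_type_space) geometric_steps_bound:
  assumes s: "range s \<subseteq> X"
    and h: "0 \<le> h" "h < 1"
    and step: "\<And>k. D (s k) (s (Suc k)) \<le> C * h ^ k"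
  shows "\<exists>M\<ge>0. \<forall>i p. D (s i) (s (i + p)) \<le> M * h ^ i"
proof -
  have sX: "s j \<in> X" for j
    using s by auto
  have "0 \<le> D (s 0) (s (Suc 0))"
    using D_nonneg sX by blast
  then have C: "0 \<le> C"
    using step[of 0] by simp
  obtain m0 where m0: "h ^ m0 < 1 / (2 * K)"
    using real_arch_pow_inv[of "1 / (2 * K)" h] h K_ge_1 by auto
  (* The successor makes the block length positive, as the induction below requires. *)
  define m where "m = Suc m0"
  have "h ^ m \<le> h ^ m0"
    using h by (intro power_decreasing) (auto simp: m_def)
  then have "h ^ m \<le> 1 / (2 * K)"
    using m0 by linarith
  then have block: "K * h ^ m \<le> 1 / 2"
    using K_ge_1 by (simp add: field_simps)
  define A where "A = C * (\<Sum>t<m. K ^ Suc t)"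
  have A: "0 \<le> A"
    unfolding A_def using C K_ge_1 by (intro mult_nonneg_nonneg sum_nonneg) auto
  have A_le: "A \<le> 2 * K * A"
    using mult_right_mono[of 1 "2 * K" A] A K_ge_1 by simp
  have short: "D (s i) (s (i + p)) \<le> A * h ^ i" if "p \<le> m" for i p
  proof -
    have "D (s i) (s (i + p)) \<le> (\<Sum>t<p. K ^ Suc t * D (s (i + t)) (s (Suc (i + t))))"
      using chain_bound[OF s] .
    also have "\<dots> \<le> (\<Sum>t<p. K ^ Suc t * (C * h ^ i))"
    proof (intro sum_mono mult_left_mono)
      fix t
      have "h ^ (i + t) \<le> h ^ i"
        using h by (intro power_decreasing) auto
      then show "D (s (i + t)) (s (Suc (i + t))) \<le> C * h ^ i"
        using step[of "i + t"] mult_left_mono[OF _ C] by fastforce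
    qed (use K_ge_1 in auto)
    also have "\<dots> \<le> (\<Sum>t<m. K ^ Suc t * (C * h ^ i))"
      using that K_ge_1 C h by (intro sum_mono2) auto
    also have "\<dots> = A * h ^ i"
      by (simp add: A_def sum_distrib_left sum_distrib_right algebra_simps)
    finally show ?thesis .
  qed
  have "D (s i) (s (i + p)) \<le> 2 * K * A * h ^ i" for i p
  proof (induction p arbitrary: i rule: less_induct)
    case (less p)
    show ?case
    proof (cases "p \<le> m")
      case True
      then show ?thesis
        using short[OF True, of i] mult_right_mono[OF A_le, of "h ^ i"] h by simp
    next
      case False
      then have "p - m < p" and split: "i + m + (p - m) = i + p"
        by (auto simp: m_def)
      then have tail: "D (s (i + m)) (s (i + p)) \<le> 2 * K * A * h ^ (i + m)"
        using less.IH[of "p - m" "i + m"] by simp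
      have "D (s i) (s (i + p)) \<le> K * (D (s i) (s (i + m)) + D (s (i + m)) (s (i + p)))"
        using relaxed_triangle sX by blast
      also have "\<dots> \<le> K * (A * h ^ i + 2 * K * A * h ^ (i + m))"
        using short[of m i] tail K_ge_1 by (intro mult_left_mono add_mono) auto
      also have "\<dots> = K * A * h ^ i + (K * h ^ m) * (2 * K * A * h ^ i)"
        by (simp add: algebra_simps power_add)
      also have "\<dots> \<le> K * A * h ^ i + 1 / 2 * (2 * K * A * h ^ i)"
        using block K_ge_1 A h by (intro add_left_mono mult_right_mono) auto
      also have "\<dots> = 2 * K * A * h ^ i"
        by simp
      finally show ?thesis .
    qed
  qed
  moreover have "0 \<le> 2 * K * A"
    using A A_le by linarith
  ultimately show ?thesis
    by blast
qed

lemma (in metric_type_space) Cauchy_of_geometric_steps: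
  assumes s: "range s \<subseteq> X"
    and h: "0 \<le> h" "h < 1"
    and step: "\<And>k. D (s k) (s (Suc k)) \<le> C * h ^ k"
  shows "mt_Cauchy D s"
proof -
  have sX: "s j \<in> X" for j
    using s by auto
  obtain M where M: "0 \<le> M" "\<And>i p. D (s i) (s (i + p)) \<le> M * h ^ i"
    using geometric_steps_bound[OF s h step] by blast
  have bound: "D (s i) (s j) \<le> M * h ^ i + M * h ^ j" for i j
  proof (cases "i \<le> j")
    case True
    then have "D (s i) (s j) \<le> M * h ^ i"
      using M(2)[of i "j - i"] by simp
    then show ?thesis using M(1) h(1) by (simp add: add_increasing2)
  next
    case False
    then have "D (s j) (s i) \<le> M * h ^ j"
      using M(2)[of j "i - j"] by simp
    then show ?thesis using M(1) h(1) D_sym[OF sX[of i] sX[of j]] by (simp add: add_increasing)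
  qed
  have null: "(\<lambda>k. M * h ^ k) \<longlonglongrightarrow> 0"
    using tendsto_mult_right_zero[OF LIMSEQ_power_zero[of h], of M] h by simp
  have "((\<lambda>q. M * h ^ fst q + M * h ^ snd q) \<longlongrightarrow> 0 + 0) (sequentially \<times>\<^sub>F sequentially)"
    by (intro tendsto_add filterlim_compose[OF null])
      (simp_all add: filterlim_def filtermap_fst_prod_filter filtermap_snd_prod_filter)
  then have upper: "((\<lambda>q. M * h ^ fst q + M * h ^ snd q) \<longlongrightarrow> 0) (sequentially \<times>\<^sub>F sequentially)"
    by simp
  show ?thesis
    unfolding mt_Cauchy_def
  proof (rule tendsto_sandwich[OF _ _ tendsto_const upper])
    show "\<forall>\<^sub>F q in sequentially \<times>\<^sub>F sequentially. 0 \<le> (case q of (i, j) \<Rightarrow> D (s i) (s j))"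
      using D_nonneg sX by (intro always_eventually) auto
    show "\<forall>\<^sub>F q in sequentially \<times>\<^sub>F sequentially.
        (case q of (i, j) \<Rightarrow> D (s i) (s j)) \<le> M * h ^ fst q + M * h ^ snd q"
      using bound by (intro always_eventually) auto
  qed
qed

section \<open>The contractive condition\<close>

definition ciric_max :: "('a \<Rightarrow> 'a \<Rightarrow> real) \<Rightarrow> ('a \<Rightarrow> 'a) \<Rightarrow> ('a \<Rightarrow> 'a) \<Rightarrow> 'a \<Rightarrow> 'a \<Rightarrow> real" where
  "ciric_max D S T x y =
     Max {D x y, D x (S x), D y (T y), 1 / 2 * (D x (T y) + D y (S x))}"

lemma ciric_max_le_iff:
  "ciric_max D S T x y \<le> b \<longleftrightarrow>
     D x y \<le> b \<and> D x (S x) \<le> b \<and> D y (T y) \<le> b \<and> (D x (T y) + D y (S x)) / 2 \<le> b"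
  by (simp add: ciric_max_def)

lemma (in metric_type_space) eq_of_self_contraction:
  assumes "x \<in> X" "y \<in> X" "l < 1" "D x y \<le> l * D x y"
  shows "x = y"
proof -
  have "(1 - l) * D x y \<le> 0"
    using assms(4) by (simp add: algebra_simps)
  then have "D x y \<le> 0"
    using assms(3) by (simp add: mult_le_0_iff)
  then show ?thesis
    using D_nonneg[of x y] D_zero_imp_eq[of x y] assms(1,2) by simp
qed

lemma (in metric_type_space) common_fixed_of_fixed:
  assumes u: "u \<in> X" "T u = u" and Su: "S u \<in> X" and l: "0 \<le> l" "l < 1"
    and contr: "D (S u) (T u) \<le> l * ciric_max D S T u u"
  shows "S u = u"
proof -
  have "ciric_max D S T u u \<le> D (S u) u"
    using u Su D_self[OF u(1)] D_nonneg[OF Su u(1)] D_sym[OF Su u(1)]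
    by (simp add: ciric_max_le_iff)
  then have "D (S u) u \<le> l * D (S u) u"
    using contr u(2) mult_left_mono[OF _ l(1)] by fastforce
  then show ?thesis
    using eq_of_self_contraction[OF Su u(1) l(2)] by simp
qed

lemma (in metric_type_space) fixed_points_coincide:
  assumes u: "u \<in> X" "T u = u" and v: "v \<in> X" "S v = v" and l: "0 \<le> l" "l < 1"
    and contr: "D (S v) (T u) \<le> l * ciric_max D S T v u"
  shows "v = u"
proof -
  have "ciric_max D S T v u \<le> D v u"
    using u v D_self[OF u(1)] D_self[OF v(1)] D_nonneg[OF v(1) u(1)] D_sym[OF v(1) u(1)]
    by (simp add: ciric_max_le_iff)
  then have "D v u \<le> l * D v u"
    using contr u(2) v(2) mult_left_mono[OF _ l(1)] by fastforce
  then show ?thesis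
    using eq_of_self_contraction[OF v(1) u(1) l(2)] by simp
qed

section \<open>Existence of a fixed point of a single map\<close>

text \<open>
  Let \<open>d\<close> and \<open>e\<close> be the first and the second step of the orbit. The relaxed triangle inequality
  replaces the mixed term by \<open>K * (d + e) / 2\<close>, so the whole maximum is at most \<open>K * max d e\<close>. The
  alternative \<open>e \<le> l * K * e\<close> forces \<open>e = 0\<close>, which leaves \<open>e \<le> l * K * d\<close>.
\<close>
lemma (in metric_type_space) orbit_step_contracts:
  assumes T: "T \<in> X \<rightarrow> X" and l: "0 \<le> l" "l * K < 1" and x: "x \<in> X"
    and contr: "D (T x) (T (T x)) \<le> l * ciric_max D T T x (T x)"
  shows "D (T x) (T (T x)) \<le> l * K * D x (T x)"
proof -
  have Tx: "T x \<in> X" and TTx: "T (T x) \<in> X"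
    using T x by auto
  define d where "d = D x (T x)"
  define e where "e = D (T x) (T (T x))"
  have nonneg: "0 \<le> d" "0 \<le> e"
    using D_nonneg x Tx TTx by (auto simp: d_def e_def)
  have scale: "max d e \<le> K * max d e"
    using mult_right_mono[of 1 K "max d e"] K_ge_1 nonneg by simp
  have "D x (T (T x)) \<le> K * (d + e)"
    unfolding d_def e_def using relaxed_triangle x Tx TTx by blast
  also have "\<dots> \<le> K * (2 * max d e)"
    using K_ge_1 by (intro mult_left_mono) auto
  finally have mixed: "D x (T (T x)) / 2 \<le> K * max d e"
    by simp
  have "ciric_max D T T x (T x) \<le> K * max d e"
    using scale mixed D_self[OF Tx]
    by (simp add: ciric_max_le_iff flip: d_def e_def)
  then have e_le: "e \<le> l * K * max d e"
    using contr mult_left_mono[OF _ l(1)] unfolding e_def by (fastforce simp: mult.assoc)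
  have lK: "0 \<le> l * K"
    using l K_ge_1 by simp
  have "e \<le> l * K * d"
  proof (cases "e \<le> d")
    case True
    then show ?thesis using e_le by (simp add: max_def)
  next
    case False
    then have "e \<le> l * K * e"
      using e_le by (simp add: max_def)
    then have "(1 - l * K) * e \<le> 0"
      by (simp add: algebra_simps)
    then have "e \<le> 0"
      using l(2) by (simp add: mult_le_0_iff)
    then show ?thesis
      using False nonneg by linarith
  qed
  then show ?thesis
    by (simp add: d_def e_def)
qed

text \<open>
  A perturbed recursion of this kind forgets its initial value at the rate \<open>1 / 2\<close>, so
  \<open>b\<close> is eventually at most \<open>a\<close> plus a little more than \<open>c\<close>, even if it does not converge.
\<close>
lemma halving_recursion_bound:
  fixes b :: "nat \<Rightarrow> real"
  assumes "0 \<le> a" "0 \<le> c" "0 \<le> b 0"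
    and rec: "\<And>k. b (Suc k) \<le> max (a + c) ((b k + c) / 2)"
  shows "b k \<le> a + c + b 0 / 2 ^ k"
proof (induction k)
  case 0
  then show ?case using assms by simp
next
  case (Suc k)
  have "b k + c \<le> 2 * a + 2 * c + b 0 / 2 ^ k"
    using Suc.IH assms(1) by linarith
  then have "(b k + c) / 2 \<le> (2 * a + 2 * c + b 0 / 2 ^ k) / 2"
    by (rule divide_right_mono) simp
  also have "\<dots> = a + c + b 0 / 2 ^ Suc k"
    by (simp add: add_divide_distrib)
  finally have "(b k + c) / 2 \<le> a + c + b 0 / 2 ^ Suc k" .
  moreover have "a + c \<le> a + c + b 0 / 2 ^ Suc k"
    using assms(3) by simp
  ultimately show ?case
    using rec[of k] by linarith
qed

text \<open>
  With \<open>a = D u (T u)\<close>, comparing \<open>T (s k) = s (Suc k)\<close> with \<open>T u\<close> gives, up to a small error,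
  \<open>D (s (Suc k)) (T u) \<le> l * max a (D (s k) (T u) / 2)\<close>. Estimating the mixed term
  by the relaxed triangle inequality instead of iterating would only give \<open>D (s k) (T u) \<le> K * a\<close>,
  hence \<open>a \<le> K * l * max a (K * a / 2)\<close>, which is no contradiction when \<open>a > 0\<close> and \<open>K\<close> is large.
\<close>
lemma (in metric_type_space) orbit_limit_fixed:
  assumes T: "T \<in> X \<rightarrow> X" and l: "0 \<le> l" "l * K < 1"
    and contr: "\<And>x y. x \<in> X \<Longrightarrow> y \<in> X \<Longrightarrow> D (T x) (T y) \<le> l * ciric_max D T T x y"
    and s: "range s \<subseteq> X" "\<And>k. s (Suc k) = T (s k)"
    and steps: "(\<lambda>k. D (s k) (s (Suc k))) \<longlonglongrightarrow> 0"
    and u: "u \<in> X" and lim: "mt_converges D s u"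
  shows "T u = u"
proof -
  have sX: "s j \<in> X" for j
    using s(1) by auto
  have Tu: "T u \<in> X"
    using T u by auto
  define a where "a = D u (T u)"
  have a: "0 \<le> a"
    unfolding a_def using D_nonneg u Tu by blast
  have "l * 1 \<le> l * K"
    using l(1) K_ge_1 by (intro mult_left_mono)
  then have l1: "l \<le> 1"
    using l(2) by simp
  have la: "0 \<le> l * a"
    using l(1) a by simp
  have near: "(\<lambda>k. D (s k) u) \<longlonglongrightarrow> 0"
    using lim by (simp add: mt_converges_def)
  have approx: "a \<le> l * K * a + 3 * K * c" if c: "0 < c" for c
  proof -
    have "\<forall>\<^sub>F k in sequentially. D (s k) u < c \<and> D (s k) (s (Suc k)) < c"
      using order_tendstoD(2)[OF near c] order_tendstoD(2)[OF steps c] by (rule eventually_conj)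
    then obtain N where N: "\<And>k. k \<ge> N \<Longrightarrow> D (s k) u < c" "\<And>k. k \<ge> N \<Longrightarrow> D (s k) (s (Suc k)) < c"
      unfolding eventually_sequentially by blast
    define b where "b k = D (s (N + k)) (T u)" for k
    have b: "0 \<le> b k" for k
      unfolding b_def using D_nonneg sX Tu by blast
    have rec: "b (Suc k) \<le> max (l * a + c) ((b k + c) / 2)" for k
    proof -
      let ?x = "s (N + k)"
      let ?m = "max c (max a ((b k + c) / 2))"
      have "D u (s (Suc (N + k))) < c"
        using N(1)[of "Suc (N + k)"] D_sym[OF u sX] by simp
      then have "ciric_max D T T ?x u \<le> ?m"
        using N(1)[of "N + k"] N(2)[of "N + k"]
        unfolding ciric_max_le_iff s(2)[symmetric] a_def[symmetric] b_def[symmetric]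
        by (simp add: le_max_iff_disj)
      then have "l * ciric_max D T T ?x u \<le> l * ?m"
        using l(1) by (rule mult_left_mono)
      then have "b (Suc k) \<le> l * ?m"
        using contr[OF sX[of "N + k"] u] by (simp add: b_def s(2))
      also have "\<dots> = max (l * c) (max (l * a) (l * ((b k + c) / 2)))"
        using l(1) by (simp add: max_mult_distrib_left)
      also have "\<dots> \<le> max (l * a + c) ((b k + c) / 2)"
      proof -
        have "l * c \<le> c" "l * ((b k + c) / 2) \<le> (b k + c) / 2"
          using l l1 b[of k] c by (auto intro: mult_left_le_one_le)
        then show ?thesis
          using c la by (intro max.boundedI) (simp_all only: le_max_iff_disj simp_thms, linarith+)
      qed
      finally show ?thesis .
    qed
    have "(\<lambda>k. b 0 / 2 ^ k) \<longlonglongrightarrow> 0"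
      using tendsto_mult_right_zero[OF LIMSEQ_power_zero[of "1 / 2 :: real"], of "b 0"]
      by (simp add: power_divide)
    then obtain k where k: "b 0 / 2 ^ k < c"
      using order_tendstoD(2)[OF _ c] by (metis (lifting) eventually_sequentially order_refl)
    have "b k \<le> l * a + c + b 0 / 2 ^ k"
      using la c b rec by (intro halving_recursion_bound) auto
    then have "b k \<le> l * a + 2 * c"
      using k by simp
    moreover have "D u (s (N + k)) \<le> c"
      using N(1)[of "N + k"] D_sym[OF u sX] by simp
    ultimately have "D u (s (N + k)) + b k \<le> l * a + 3 * c"
      by simp
    then have "K * (D u (s (N + k)) + b k) \<le> K * (l * a + 3 * c)"
      using K_ge_1 by (intro mult_left_mono) auto
    moreover have "a \<le> K * (D u (s (N + k)) + b k)"
      unfolding a_def b_def using relaxed_triangle u Tu sX by blast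
    ultimately show ?thesis
      by (simp add: algebra_simps)
  qed
  have "a \<le> l * K * a + c" if "0 < c" for c
    using approx[of "c / (3 * K)"] that K_ge_1 by simp
  then have "a \<le> l * K * a"
    by (rule field_le_epsilon)
  then show ?thesis
    using eq_of_self_contraction[OF u Tu l(2)] unfolding a_def by simp
qed

lemma (in metric_type_space) ciric_fixed_point_exists:
  assumes complete: "mt_complete X D"
    and T: "T \<in> X \<rightarrow> X" and l: "0 \<le> l" "l * K < 1"
    and contr: "\<And>x y. x \<in> X \<Longrightarrow> y \<in> X \<Longrightarrow> D (T x) (T y) \<le> l * ciric_max D T T x y"
  shows "\<exists>u\<in>X. T u = u"
proof -
  obtain x0 where x0: "x0 \<in> X"
    using nonempty by blast
  define s where "s k = (T ^^ k) x0" for k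
  have s_Suc: "s (Suc k) = T (s k)" for k
    by (simp add: s_def)
  have sX: "s k \<in> X" for k
    by (induction k) (use x0 T in \<open>auto simp: s_def\<close>)
  then have range: "range s \<subseteq> X"
    by auto
  have lK: "0 \<le> l * K"
    using l(1) K_ge_1 by simp
  define C where "C = D (s 0) (s (Suc 0))"
  have step: "D (s k) (s (Suc k)) \<le> C * (l * K) ^ k" for k
  proof (induction k)
    case 0
    then show ?case by (simp add: C_def)
  next
    case (Suc k)
    have "D (s (Suc k)) (s (Suc (Suc k))) \<le> l * K * D (s k) (s (Suc k))"
      using orbit_step_contracts[OF T l sX contr] sX T by (auto simp: s_Suc)
    also have "\<dots> \<le> l * K * (C * (l * K) ^ k)"
      using Suc.IH lK by (rule mult_left_mono)
    also have "\<dots> = C * (l * K) ^ Suc k"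
      by simp
    finally show ?case .
  qed
  have "mt_Cauchy D s"
    using Cauchy_of_geometric_steps[OF range lK l(2) step] .
  then obtain u where u: "u \<in> X" "mt_converges D s u"
    using complete range unfolding mt_complete_def by blast
  have "(\<lambda>k. C * (l * K) ^ k) \<longlonglongrightarrow> 0"
    using tendsto_mult_right_zero[OF LIMSEQ_power_zero[of "l * K"], of C] lK l(2) by simp
  then have "(\<lambda>k. D (s k) (s (Suc k))) \<longlonglongrightarrow> 0"
    by (rule tendsto_sandwich[OF _ _ tendsto_const, rotated 2])
      (use D_nonneg sX step in auto)
  then have "T u = u"
    using orbit_limit_fixed[OF T l contr range s_Suc _ u] by blast
  then show ?thesis
    using u(1) by blast
qed

section \<open>The common fixed point of the family\<close>

theorem theorem5p1:
  fixes X :: "'a set" and D :: "'a \<Rightarrow> 'a \<Rightarrow> real" and K :: real and n :: nat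
    and J :: "'i set" and T :: "'i \<Rightarrow> 'a \<Rightarrow> 'a" and \<beta> :: 'i
  assumes "metric_type_space X D K n"
    and "mt_complete X D"
    and "\<And>\<alpha>. \<alpha> \<in> J \<Longrightarrow> T \<alpha> \<in> X \<rightarrow> X"
    and "\<beta> \<in> J"
    and "\<And>\<alpha>. \<alpha> \<in> J \<Longrightarrow> \<exists>l::real. 0 \<le> l \<and> l < 1 \<and> l * K < 1 \<and>
          (\<forall>x\<in>X. \<forall>y\<in>X. D (T \<alpha> x) (T \<beta> y) \<le>
             l * Max {D x y, D x (T \<alpha> x), D y (T \<beta> y), 1 / 2 * (D x (T \<beta> y) + D y (T \<alpha> x))})"
  shows "(\<exists>!u. common_fixed_point X J T u) \<and>
         (\<forall>u. common_fixed_point X J T u \<longrightarrow> (\<forall>\<alpha>\<in>J. {v \<in> X. T \<alpha> v = v} = {u}))"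
proof -
  interpret metric_type_space X D K n
    using assms(1) .
  have contr: "\<exists>l. 0 \<le> l \<and> l < 1 \<and> l * K < 1 \<and>
      (\<forall>x\<in>X. \<forall>y\<in>X. D (T \<alpha> x) (T \<beta> y) \<le> l * ciric_max D (T \<alpha>) (T \<beta>) x y)" if "\<alpha> \<in> J" for \<alpha>
    unfolding ciric_max_def using assms(5)[OF that] .
  obtain l where "0 \<le> l" "l * K < 1"
    "\<And>x y. x \<in> X \<Longrightarrow> y \<in> X \<Longrightarrow> D (T \<beta> x) (T \<beta> y) \<le> l * ciric_max D (T \<beta>) (T \<beta>) x y"
    using contr[OF \<open>\<beta> \<in> J\<close>] by blast
  then obtain u where u: "u \<in> X" "T \<beta> u = u"
    using ciric_fixed_point_exists[OF assms(2) assms(3)[OF \<open>\<beta> \<in> J\<close>]] by blast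
  have fixed: "{v \<in> X. T \<alpha> v = v} = {u}" if \<alpha>: "\<alpha> \<in> J" for \<alpha>
  proof -
    obtain l where l: "0 \<le> l" "l < 1"
      "\<And>x y. x \<in> X \<Longrightarrow> y \<in> X \<Longrightarrow> D (T \<alpha> x) (T \<beta> y) \<le> l * ciric_max D (T \<alpha>) (T \<beta>) x y"
      using contr[OF \<alpha>] by blast
    have "T \<alpha> u \<in> X"
      using assms(3)[OF \<alpha>] u(1) by auto
    then have "T \<alpha> u = u"
      using common_fixed_of_fixed[of u "T \<beta>" "T \<alpha>"] u l by blast
    moreover have "v = u" if "v \<in> X" "T \<alpha> v = v" for v
      using fixed_points_coincide[of u "T \<beta>" v "T \<alpha>"] u l that by blast
    ultimately show ?thesis
      using u(1) by blast
  qed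
  have "common_fixed_point X J T v \<longleftrightarrow> v = u" for v
  proof
    assume "common_fixed_point X J T v"
    then have "v \<in> {w \<in> X. T \<beta> w = w}"
      using \<open>\<beta> \<in> J\<close> by (auto simp: common_fixed_point_def)
    then show "v = u"
      using fixed[OF \<open>\<beta> \<in> J\<close>] by blast
  next
    have "T \<alpha> u = u" if "\<alpha> \<in> J" for \<alpha>
      using fixed[OF that] by blast
    moreover assume "v = u"
    ultimately show "common_fixed_point X J T v"
      using u(1) by (simp add: common_fixed_point_def)
  qed
  then show ?thesis
    using fixed by auto
qed

end
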